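(* Let $\lambda\in(0,\infty)$ and let $m\ge2$ be a natural number. If $p_n=1-e^{-\lambda/n}$ for all natural $n\ge1$, then $\mathsf P(X_{n,p_n}\ge m)$ is (strictly) increasing in natural $n\ge m-1$ and converges, as $n\to\infty$, to $\mathsf P(\Pi_\lambda\ge m)$. In particular, $$\mathsf P(X_{n,p_n}\ge m)<\mathsf P(\Pi_\lambda\ge m)$$ for all such $\lambda,m$ and all natural $n\ge m-1$.
   Context: $X_{n,p}$ denotes a random variable having the binomial distribution with parameters $n$ and $p$. For real $\lambda>0$, $\Pi_\lambda$ denotes a random variable having the Poisson distribution with parameter $\lambda$. *)

theory Defs
  imports "HOL-Probability.Probability"
begin

end

theory Submission
  imports Defs "HOL-Real_Asymp.Real_Asymp"
begin

text \<open>
  As a function of \<open>x\<close>, with \<open>p = 1 - exp (- x / n)\<close>, the tail \<open>P(X \<ge> m)\<close> has the derivative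
  \<open>exp (- x) * (n - 1 choose m - 1) * (exp (x / n) - 1) ^ (m - 1)\<close>. The ratio of these derivatives
  for \<open>n + 1\<close> and \<open>n\<close> is strictly decreasing in \<open>x\<close>, so the difference of the two tails can only
  increase first and decrease afterwards. It vanishes at \<open>0\<close> and at infinity, hence it is positive
  in between. The strict bound by the Poisson tail then follows from monotonicity and the limit.
\<close>

text \<open>\<open>P(X < m)\<close> for \<open>X\<close> binomial with parameters \<open>n\<close> and \<open>1 - exp (- x / n)\<close>: the factor
  \<open>(1 - p) ^ n = exp (- x)\<close> is pulled out, and \<open>p / (1 - p) = exp (x / n) - 1\<close>.\<close>
definition low_tail :: "nat \<Rightarrow> nat \<Rightarrow> real \<Rightarrow> real" where
  "low_tail n m x = exp (- x) * (\<Sum>k<m. real (n choose k) * (exp (x / real n) - 1) ^ k)"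

section \<open>Closed form of the binomial tail and its special values\<close>

lemma prob_atLeast_nat_pmf:
  fixes M :: "nat pmf"
  shows "measure_pmf.prob M {k. k \<ge> m} = 1 - (\<Sum>k<m. pmf M k)"
proof -
  have "measure_pmf.prob M {k. k \<ge> m} = measure_pmf.prob M (space (measure_pmf M) - {..<m})"
    by (intro arg_cong[where f = "measure_pmf.prob M"]) auto
  also have "\<dots> = 1 - measure_pmf.prob M {..<m}"
    by (rule measure_pmf.prob_compl) simp
  finally show ?thesis
    by (simp add: measure_measure_pmf_finite)
qed

lemma pmf_binomial_exp:
  fixes x :: real
  assumes "x \<ge> 0" "n \<ge> 1"
  shows "pmf (binomial_pmf n (1 - exp (- x / real n))) k
           = exp (- x) * (real (n choose k) * (exp (x / real n) - 1) ^ k)"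
proof (cases "k \<le> n")
  case True
  define q where "q = exp (- x / real n)"
  have q: "0 < q" "q \<le> 1"
    using assms by (auto simp: q_def divide_nonpos_pos)
  have qn: "q ^ n = exp (- x)"
    using assms by (simp add: q_def flip: exp_of_nat_mult)
  have inv: "exp (x / real n) = 1 / q"
    by (simp add: q_def exp_minus field_simps)
  have "(1 - q) ^ k * q ^ (n - k) = ((1 - q) / q) ^ k * (q ^ k * q ^ (n - k))"
    using q by (simp add: power_divide)
  also have "q ^ k * q ^ (n - k) = exp (- x)"
    using True qn by (simp flip: power_add)
  also have "(1 - q) / q = exp (x / real n) - 1"
    using q by (simp add: inv diff_divide_distrib)
  finally have "(1 - q) ^ k * q ^ (n - k) = (exp (x / real n) - 1) ^ k * exp (- x)" .
  then show ?thesis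
    unfolding q_def[symmetric] using q by (simp add: mult_ac)
next
  case False
  then show ?thesis
    using assms by (simp add: binomial_eq_0 divide_nonpos_pos)
qed

lemma prob_binomial_exp_ge:
  fixes x :: real
  assumes "x \<ge> 0" "n \<ge> 1"
  shows "measure_pmf.prob (binomial_pmf n (1 - exp (- x / real n))) {k. k \<ge> m}
           = 1 - low_tail n m x"
  unfolding prob_atLeast_nat_pmf pmf_binomial_exp[OF assms] low_tail_def sum_distrib_left ..

text \<open>The sum is the binomial expansion of \<open>((exp (x / n) - 1) + 1) ^ n = exp x\<close>,
  which the factor \<open>exp (- x)\<close> cancels. This covers the smallest index, where
  \<open>n\<close> trials cannot reach \<open>n + 1\<close> successes.\<close>

lemma low_tail_full:
  assumes "n \<ge> 1"
  shows "low_tail n (Suc n) x = 1"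
proof -
  have "(\<Sum>k<Suc n. real (n choose k) * (exp (x / real n) - 1) ^ k) = exp (x / real n) ^ n"
    using binomial_ring[of "exp (x / real n) - 1" 1 n] by (simp add: lessThan_Suc_atMost)
  also have "\<dots> = exp x"
    using assms by (simp flip: exp_of_nat_mult)
  finally show ?thesis
    by (simp add: low_tail_def exp_minus)
qed

text \<open>Compared with the full sum, the term \<open>k = n\<close> is missing, and it is positive
  for \<open>x > 0\<close>.\<close>

lemma low_tail_self_less_1:
  assumes "n \<ge> 1" "x > 0"
  shows "low_tail n n x < 1"
proof -
  have "low_tail n n x < low_tail n (Suc n) x"
    using assms by (simp add: low_tail_def algebra_simps)
  then show ?thesis
    using assms by (simp add: low_tail_full)
qed

lemma low_tail_0: "m \<ge> 1 \<Longrightarrow> low_tail n m 0 = 1"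
proof -
  assume "m \<ge> 1"
  then obtain m' where "m = Suc m'"
    by (cases m) auto
  then show ?thesis
    by (simp add: low_tail_def sum.lessThan_Suc_shift)
qed

section \<open>Derivative in \<open>x\<close> and decay at infinity\<close>

text \<open>The derivatives of the summands telescope: by absorption, part of the derivative of each
  new term cancels the derivative obtained so far, and Pascal's rule turns the remainder into the
  next coefficient.\<close>

lemma has_real_derivative_low_tail:
  assumes "n \<ge> 1"
  shows "(low_tail n (Suc m) has_real_derivative
            - (exp (- x) * (real ((n - 1) choose m) * (exp (x / real n) - 1) ^ m))) (at x)"
proof (induction m)
  case 0
  have "low_tail n (Suc 0) = (\<lambda>x. exp (- x))"
    by (auto simp: low_tail_def)
  then show ?case
    by (auto intro!: derivative_eq_intros)
next
  case (Suc m)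
  define y where "y = exp (x / real n) - 1"
  define c where "c = real (n choose Suc m)"
  have split: "low_tail n (Suc (Suc m))
    = (\<lambda>x. low_tail n (Suc m) x + exp (- x) * (c * (exp (x / real n) - 1) ^ Suc m))"
    by (auto simp: low_tail_def c_def algebra_simps)
  obtain n' where n: "n = Suc n'"
    using assms by (cases n) auto
  have absorb: "c * real (Suc m) / real n = real ((n - 1) choose m)"
  proof -
    have "Suc m * (n choose Suc m) = n * (n' choose m)"
      unfolding n binomial_absorption by simp
    then have "real (Suc m) * c = real n * real (n' choose m)"
      unfolding c_def by (metis of_nat_mult)
    then show ?thesis
      by (simp add: n field_simps)
  qed
  have pascal: "c = real ((n - 1) choose m) + real ((n - 1) choose Suc m)"
    by (simp add: c_def n)
  \<comment> \<open>Here \<open>exp (x / n)\<close> is rewritten as \<open>y + 1\<close>, so that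
    everything except \<open>exp (- x)\<close> becomes a polynomial in \<open>y\<close>.\<close>
  have "((\<lambda>x. exp (x / real n) - 1) has_real_derivative (y + 1) / real n) (at x)"
    unfolding y_def using assms by (auto intro!: derivative_eq_intros)
  note dpow = DERIV_power[OF this, of "Suc m", folded y_def]
  have "((\<lambda>x. exp (- x)) has_real_derivative - exp (- x)) (at x)"
    by (auto intro!: derivative_eq_intros)
  from DERIV_mult[OF this DERIV_cmult[OF dpow, of c]]
  have "((\<lambda>x. exp (- x) * (c * (exp (x / real n) - 1) ^ Suc m)) has_real_derivative
     exp (- x) * (c * real (Suc m) / real n * y ^ m * (y + 1)) - exp (- x) * (c * y ^ Suc m)) (at x)"
    by (rule DERIV_cong) (simp add: y_def algebra_simps)
  from DERIV_add[OF Suc this]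
  have "(low_tail n (Suc (Suc m)) has_real_derivative
     - (exp (- x) * (real ((n - 1) choose m) * y ^ m))
     + (exp (- x) * (c * real (Suc m) / real n * y ^ m * (y + 1)) - exp (- x) * (c * y ^ Suc m))) (at x)"
    unfolding split y_def .
  also have "- (exp (- x) * (real ((n - 1) choose m) * y ^ m))
     + (exp (- x) * (c * real (Suc m) / real n * y ^ m * (y + 1)) - exp (- x) * (c * y ^ Suc m))
     = - (exp (- x) * (real ((n - 1) choose Suc m) * y ^ Suc m))"
    unfolding absorb unfolding pascal by (simp add: algebra_simps)
  finally show ?case
    by (simp add: y_def)
qed

text \<open>Every index satisfies \<open>k < m \<le> n\<close>, so the growth
  \<open>exp (k * x / n)\<close> of the power loses against \<open>exp (- x)\<close>, leaving
  exponential decay at the positive rate \<open>1 - k / n\<close>.\<close>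

lemma low_tail_tendsto_0:
  assumes "n \<ge> m"
  shows "(low_tail n m \<longlongrightarrow> 0) at_top"
proof -
  have "((\<lambda>x. exp (- x) * (real (n choose k) * (exp (x / real n) - 1) ^ k)) \<longlongrightarrow> 0) at_top"
    if "k < m" for k
  proof (rule tendsto_sandwich)
    have n: "real n > 0" "real k < real n"
      using that assms by auto
    show "\<forall>\<^sub>F x in at_top. 0 \<le> exp (- x) * (real (n choose k) * (exp (x / real n) - 1) ^ k)"
      using eventually_ge_at_top[of "0::real"] by eventually_elim simp
    show "\<forall>\<^sub>F x in at_top. exp (- x) * (real (n choose k) * (exp (x / real n) - 1) ^ k)
            \<le> real (n choose k) * exp (- (1 - real k / real n) * x)"
      using eventually_ge_at_top[of "0::real"]
    proof eventually_elim
      case (elim x)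
      have "(exp (x / real n) - 1) ^ k \<le> exp (x / real n) ^ k"
        using elim by (intro power_mono) auto
      also have "\<dots> = exp (real k * x / real n)"
        by (simp flip: exp_of_nat_mult)
      finally have "exp (- x) * (real (n choose k) * (exp (x / real n) - 1) ^ k)
          \<le> exp (- x) * (real (n choose k) * exp (real k * x / real n))"
        by (intro mult_left_mono) auto
      also have "\<dots> = real (n choose k) * (exp (- x) * exp (real k * x / real n))"
        by simp
      also have "exp (- x) * exp (real k * x / real n) = exp (- (1 - real k / real n) * x)"
        by (simp add: algebra_simps flip: exp_add)
      finally show ?case .
    qed
    define d where "d = 1 - real k / real n"
    have "d > 0"
      using n by (simp add: d_def)
    then have "((\<lambda>x. real (n choose k) * exp (- d * x)) \<longlongrightarrow> 0) at_top"
      by real_asymp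
    then show "((\<lambda>x. real (n choose k) * exp (- (1 - real k / real n) * x)) \<longlongrightarrow> 0) at_top"
      unfolding d_def .
  qed simp
  then have "((\<lambda>x. \<Sum>k<m. exp (- x) * (real (n choose k) * (exp (x / real n) - 1) ^ k))
              \<longlongrightarrow> (\<Sum>k<m. 0)) at_top"
    by (intro tendsto_sum) auto
  then show ?thesis
    by (simp add: low_tail_def[abs_def] sum_distrib_left)
qed

section \<open>Monotonicity of the ratio of derivatives\<close>

text \<open>Cross-multiplied form of the fact that \<open>(w ^ n - 1) / (w ^ Suc n - 1)\<close>
  strictly decreases for \<open>w > 1\<close>. After removal of the factors \<open>w - 1\<close>,
  geometric sums remain, which are compared term by term.\<close>

lemma power_minus_one_cross_less:
  fixes u v :: real
  assumes "1 < u" "u < v" "n \<ge> 1"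
  shows "(v ^ n - 1) * (u ^ Suc n - 1) < (v ^ Suc n - 1) * (u ^ n - 1)"
proof -
  define S where "S w = (\<Sum>i<n. w ^ i)" for w :: real
  have S: "w ^ n - 1 = (w - 1) * S w" "w ^ Suc n - 1 = (w - 1) * (S w + w ^ n)" for w :: real
    using power_diff_1_eq[of w n] power_diff_1_eq[of w "Suc n"] by (simp_all add: S_def)
  have "S v * u ^ n < S u * v ^ n"
    unfolding S_def sum_distrib_right
  proof (rule sum_strict_mono)
    fix i assume "i \<in> {..<n}"
    then have i: "i < n" by simp
    have "u ^ (n - i) < v ^ (n - i)"
      using assms i by (intro power_strict_mono) auto
    then have "u ^ i * v ^ i * u ^ (n - i) < u ^ i * v ^ i * v ^ (n - i)"
      using assms by (intro mult_strict_left_mono) auto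
    moreover have "w ^ n = w ^ i * w ^ (n - i)" for w :: real
      using i by (simp flip: power_add)
    ultimately show "v ^ i * u ^ n < u ^ i * v ^ n"
      by (simp add: mult_ac)
  qed (use assms(3) in \<open>auto simp: lessThan_empty_iff\<close>)
  \<comment> \<open>Both sides gain the same product \<open>S v * S u\<close>.\<close>
  then have "S v * (S u + u ^ n) < (S v + v ^ n) * S u"
    by (simp add: algebra_simps)
  then have "((v - 1) * (u - 1)) * (S v * (S u + u ^ n)) < ((v - 1) * (u - 1)) * ((S v + v ^ n) * S u)"
    using assms by (intro mult_strict_left_mono) auto
  then show ?thesis
    unfolding S by (simp add: mult_ac)
qed

text \<open>Up to a constant factor, the \<open>m\<close>-th power of this quotient is the ratio of
  the derivatives of \<open>low_tail (Suc n) (Suc m)\<close> and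
  \<open>low_tail n (Suc m)\<close>.\<close>

lemma exp_ratio_strict_antimono:
  fixes x y :: real
  assumes "0 < x" "x < y" "n \<ge> 1"
  shows "(exp (y / real (Suc n)) - 1) / (exp (y / real n) - 1)
           < (exp (x / real (Suc n)) - 1) / (exp (x / real n) - 1)"
proof -
  \<comment> \<open>common root, so that both exponentials become consecutive powers\<close>
  define e where "e z = exp (z / (real n * real (Suc n)))" for z :: real
  have e: "exp (z / real (Suc n)) = e z ^ n" "exp (z / real n) = e z ^ Suc n" for z :: real
    using assms by (simp_all add: e_def del: power_Suc of_nat_Suc flip: exp_of_nat_mult)
  have "1 < e x" "e x < e y"
    using assms by (auto simp: e_def intro!: divide_strict_right_mono mult_pos_pos)
  moreover from this have "e x ^ Suc n > 1" "e y ^ Suc n > 1"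
    by (auto intro!: one_less_power simp del: power_Suc)
  ultimately show ?thesis
    using power_minus_one_cross_less[of "e x" "e y" n] assms(3)
    unfolding e by (simp add: divide_less_eq less_divide_eq mult_ac del: power_Suc)
qed

section \<open>Strict monotonicity in \<open>n\<close>\<close>

text \<open>If the difference \<open>h\<close> were nonpositive at \<open>x\<close>, then, as
  \<open>h 0 = 0\<close>, its derivative would be nonpositive at some \<open>z\<close> in between.
  The decreasing ratio makes the derivative negative beyond \<open>z\<close>, so \<open>h\<close>
  would keep falling below 0 after \<open>x\<close>, against its limit 0 at infinity.\<close>

lemma low_tail_Suc_less:
  assumes "n \<ge> Suc m" "m \<ge> 1" "x > 0"
  shows "low_tail (Suc n) (Suc m) x < low_tail n (Suc m) x"
proof (rule ccontr)
  define h where "h t = low_tail n (Suc m) t - low_tail (Suc n) (Suc m) t" for t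
  define r where "r t = (exp (t / real (Suc n)) - 1) / (exp (t / real n) - 1)" for t
  define a where "a = real ((n - 1) choose m)"
  define b where "b = real (n choose m)"
  \<comment> \<open>For \<open>t > 0\<close> the factors before the bracket are positive, so the
    sign of the derivative is that of \<open>b * r t ^ m - a\<close>.\<close>
  define h' where "h' t = exp (- t) * (exp (t / real n) - 1) ^ m * (b * r t ^ m - a)" for t
  assume "\<not> ?thesis"
  then have hx: "h x \<le> 0" by (simp add: h_def)
  have b: "b > 0" using assms by (simp add: b_def)
  have deriv: "(h has_real_derivative h' t) (at t)" if "t > 0" for t
  proof -
    have "exp (t / real n) - 1 > 0"
      using that assms by simp
    then have "exp (t / real (Suc n)) - 1 = (exp (t / real n) - 1) * r t"
      using assms by (simp add: r_def)
    then have "(exp (t / real (Suc n)) - 1) ^ m = (exp (t / real n) - 1) ^ m * r t ^ m"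
      by (simp only: power_mult_distrib)
    then have "h' t = - (exp (- t) * (a * (exp (t / real n) - 1) ^ m))
        - - (exp (- t) * (b * (exp (t / real (Suc n)) - 1) ^ m))"
      by (simp add: h'_def algebra_simps)
    then show ?thesis
      unfolding h_def[abs_def] a_def b_def using assms
      using DERIV_diff[OF has_real_derivative_low_tail[of n m t]
                          has_real_derivative_low_tail[of "Suc n" m t]]
      by simp
  qed
  have cont: "continuous_on {0..x} h"
    unfolding h_def[abs_def]
    by (intro continuous_on_diff DERIV_continuous_on)
       (use assms in \<open>auto intro!: has_real_derivative_low_tail[THEN has_field_derivative_at_within]\<close>)
  have h0: "h 0 = 0"
    by (simp add: h_def low_tail_0)
  obtain z where z: "0 < z" "z < x" "h x - h 0 = (x - 0) * h' z"
  proof -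
    obtain l z where lz: "0 < z" "z < x" "(h has_real_derivative l) (at z)" "h x - h 0 = (x - 0) * l"
      using MVT[OF assms(3) cont] deriv by (metis real_differentiable_def)
    moreover have "l = h' z"
      using DERIV_unique[OF lz(3) deriv[OF lz(1)]] .
    ultimately show ?thesis
      using that by blast
  qed
  have neg: "h' t < 0" if "t > z" for t
  proof -
    \<comment> \<open>A positive bracket would give \<open>h' z > 0\<close>, whereas
      \<open>x * h' z = h x \<le> 0\<close>.\<close>
    have "b * r z ^ m - a \<le> 0"
    proof (rule ccontr)
      assume "\<not> ?thesis"
      moreover have "exp (z / real n) - 1 > 0"
        using z assms by simp
      ultimately have "h' z > 0"
        by (simp add: h'_def)
      then show False
        using z hx h0 assms by (smt (verit) mult_pos_pos)
    qed
    \<comment> \<open>Strictness survives the power because \<open>m \<ge> 1\<close>.\<close>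
    moreover have "r t ^ m < r z ^ m"
      using exp_ratio_strict_antimono[OF z(1) that, of n] z that assms
      by (intro power_strict_mono) (auto simp: r_def)
    ultimately have "b * r t ^ m - a < 0"
      using b by (smt (verit) mult_strict_left_mono)
    moreover have "exp (t / real n) - 1 > 0"
      using z that assms by simp
    ultimately show ?thesis
      by (simp add: h'_def mult_pos_neg)
  qed
  have decr: "h t < h s" if "x \<le> s" "s < t" for s t
  proof (rule DERIV_neg_imp_decreasing[OF that(2)])
    fix u assume "s \<le> u"
    with that z have "u > z" "u > 0" by auto
    with neg deriv show "\<exists>y. (h has_real_derivative y) (at u) \<and> y < 0"
      by blast
  qed
  have "(h \<longlongrightarrow> 0 - 0) at_top"
    unfolding h_def[abs_def] using assms
    by (intro tendsto_diff low_tail_tendsto_0) auto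
  \<comment> \<open>Limits preserve only weak inequalities. The intermediate point
    \<open>x + 1\<close> keeps the contradiction strict:
    \<open>0 \<le> h (x + 1) < h x \<le> 0\<close>.\<close>
  moreover have "\<forall>\<^sub>F t in at_top. h t \<le> h (x + 1)"
    using eventually_gt_at_top[of "x + 1"] by eventually_elim (simp add: decr less_imp_le)
  ultimately have "0 - 0 \<le> h (x + 1)"
    by (rule tendsto_upperbound) simp
  with decr[of x "x + 1"] hx show False by simp
qed

section \<open>The Poisson limit\<close>

text \<open>Passing from \<open>k\<close> to \<open>k + 1\<close> multiplies the term by
  \<open>(n - k) * (exp (x / n) - 1) / (k + 1)\<close>, which tends to \<open>x / (k + 1)\<close>
  since \<open>exp (x / n) - 1\<close> behaves like \<open>x / n\<close>.\<close>

lemma binomial_exp_power_tendsto: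
  fixes x :: real
  assumes "x > 0"
  shows "(\<lambda>n. real (n choose k) * (exp (x / real n) - 1) ^ k) \<longlonglongrightarrow> x ^ k / fact k"
proof (induction k)
  case (Suc k)
  have "(\<lambda>n. (real n - real k) * (exp (x / real n) - 1)) \<longlonglongrightarrow> x"
    using assms by real_asymp
  then have "(\<lambda>n. (real n - real k) * (exp (x / real n) - 1) / real (Suc k)) \<longlonglongrightarrow> x / real (Suc k)"
    by (intro tendsto_intros) auto
  from tendsto_mult[OF Suc this]
  have "(\<lambda>n. real (n choose k) * (exp (x / real n) - 1) ^ k *
           ((real n - real k) * (exp (x / real n) - 1) / real (Suc k)))
        \<longlonglongrightarrow> x ^ Suc k / fact (Suc k)"
    by (simp add: field_simps)
  also have "(\<lambda>n. real (n choose k) * (exp (x / real n) - 1) ^ k *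
           ((real n - real k) * (exp (x / real n) - 1) / real (Suc k)))
      = (\<lambda>n. real (n choose Suc k) * (exp (x / real n) - 1) ^ Suc k)"
  proof
    fix n
    \<comment> \<open>Generalized binomial coefficients give this identity for every
      \<open>n\<close>, including \<open>n \<le> k\<close>.\<close>
    have "real (Suc k) * real (n choose Suc k) = (real n - real k) * real (n choose k)"
      using gbinomial_absorb_comp[of "real n" k] gbinomial_absorption[of k "real n"]
      by (simp add: binomial_gbinomial del: of_nat_Suc)
    then have "real (n choose Suc k) = (real n - real k) * real (n choose k) / real (Suc k)"
      by (simp add: field_simps)
    then show "real (n choose k) * (exp (x / real n) - 1) ^ k *
           ((real n - real k) * (exp (x / real n) - 1) / real (Suc k))
         = real (n choose Suc k) * (exp (x / real n) - 1) ^ Suc k"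
      by simp
  qed
  finally show ?case .
qed simp

lemma low_tail_tendsto_poisson:
  assumes "x > 0"
  shows "(\<lambda>n. 1 - low_tail n m x) \<longlonglongrightarrow> measure_pmf.prob (poisson_pmf x) {k. k \<ge> m}"
proof -
  have "(\<lambda>n. 1 - low_tail n m x) \<longlonglongrightarrow> 1 - exp (- x) * (\<Sum>k<m. x ^ k / fact k)"
    unfolding low_tail_def using assms
    by (intro tendsto_intros binomial_exp_power_tendsto)
  also have "exp (- x) * (\<Sum>k<m. x ^ k / fact k) = (\<Sum>k<m. pmf (poisson_pmf x) k)"
    using assms by (simp add: sum_distrib_left mult_ac)
  finally show ?thesis
    by (simp only: prob_atLeast_nat_pmf)
qed

section \<open>Combination of monotonicity and limit, with the boundary index
  \<open>n = m - 1\<close>\<close>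

theorem corollary7:
  fixes lam :: real and m :: nat and p :: "nat \<Rightarrow> real"
  assumes "lam > 0" and "m \<ge> 2"
    and "\<And>n. n \<ge> 1 \<Longrightarrow> p n = 1 - exp (- lam / real n)"
  shows "strict_mono_on {n. n \<ge> m - 1}
           (\<lambda>n. measure_pmf.prob (binomial_pmf n (p n)) {k. k \<ge> m}) \<and>
         (\<lambda>n. measure_pmf.prob (binomial_pmf n (p n)) {k. k \<ge> m})
           \<longlonglongrightarrow> measure_pmf.prob (poisson_pmf lam) {k. k \<ge> m} \<and>
         (\<forall>n \<ge> m - 1. measure_pmf.prob (binomial_pmf n (p n)) {k. k \<ge> m}
           < measure_pmf.prob (poisson_pmf lam) {k. k \<ge> m})"
proof -
  define f where "f n = measure_pmf.prob (binomial_pmf n (p n)) {k. k \<ge> m}" for n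
  define L where "L = measure_pmf.prob (poisson_pmf lam) {k. k \<ge> m}"
  have f: "f n = 1 - low_tail n m lam" if "n \<ge> 1" for n
    unfolding f_def assms(3)[OF that] using that assms(1) by (intro prob_binomial_exp_ge) auto
  have step: "f n < f (Suc n)" if "n \<ge> m - 1" for n
  \<comment> \<open>At \<open>n = m - 1\<close> the tail is 0 and the next one is positive; the
    derivative comparison applies only from \<open>n = m\<close> on.\<close>
  proof (cases "n = m - 1")
    case True
    then have "m = Suc n" "n \<ge> 1"
      using assms by auto
    then show ?thesis
      using assms low_tail_self_less_1[of "Suc n" lam] by (simp add: f low_tail_full)
  next
    case False
    then show ?thesis
      using that assms low_tail_Suc_less[of "m - 1" n lam] by (simp add: f)
  qed
  have mono: "f i < f j" if "m - 1 \<le> i" "i < j" for i j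
    \<comment> \<open>The bound on \<open>i\<close> is carried through the induction; for the middle
      index it follows from \<open>i < j\<close>.\<close>
    using that(2,1)
  proof (induction rule: less_Suc_induct)
    case (1 i)
    then show ?case by (rule step)
  next
    case (2 i j k)
    then show ?case by (meson less_trans less_imp_le order_trans)
  qed
  \<comment> \<open>The value \<open>p 0\<close> is unconstrained, so the closed form is used for
    \<open>n \<ge> 1\<close> only.\<close>
  have "\<forall>\<^sub>F n in sequentially. 1 - low_tail n m lam = f n"
    using eventually_ge_at_top[of 1] by eventually_elim (simp add: f)
  with low_tail_tendsto_poisson[OF assms(1), of m] have lim: "f \<longlonglongrightarrow> L"
    unfolding L_def by (rule Lim_transform_eventually)
  have "f n < L" if "n \<ge> m - 1" for n
  proof -
    \<comment> \<open>The limit bounds the next term weakly; the strict step from \<open>n\<close>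
      to \<open>Suc n\<close> then makes the bound on \<open>f n\<close> strict.\<close>
    have "f (Suc n) \<le> L"
      using lim
    proof (rule LIMSEQ_le_const)
      have "f (Suc n) \<le> f k" if "Suc n \<le> k" for k
        using mono[of "Suc n" k] that \<open>n \<ge> m - 1\<close> by (cases "k = Suc n") auto
      then show "\<exists>N. \<forall>k\<ge>N. f (Suc n) \<le> f k" by blast
    qed
    with step[OF that] show ?thesis by simp
  qed
  with mono lim have "strict_mono_on {n. n \<ge> m - 1} f \<and> f \<longlonglongrightarrow> L \<and> (\<forall>n\<ge>m - 1. f n < L)"
    by (auto intro!: strict_mono_onI)
  then show ?thesis
    unfolding f_def L_def .
qed

end
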